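(* Let $(S,T)$ be the binary source pair with $p(0,0)=p(1,0)=p(1,1)=\tfrac13$ and $p(0,1)=0$ (where $p(s,t)=\Pr\{S=s,T=t\}$), and consider the deterministic interference channel with $\mathcal X_1=\mathcal X_2=\{0,1\}$, $\mathcal Y_1=\{0,1\}$, $\mathcal Y_2=\{0,1,2\}$, $Y_1=X_1$, $Y_2=X_1+X_2$ (integer addition). Let $\mathcal C$ be the capacity region of this channel (with independent messages), which is the convex closure of the set of pairs $(R_1,R_2)$ of nonnegative reals satisfying, for some product distribution $p(x_1)p(x_2)$ of $(X_1,X_2)$, $$R_1\le H(X_1),\qquad R_2\le H(X_2),\qquad R_1+R_2\le H(Y_2),$$ and let $\mathcal R_{SW}$ be the Slepian–Wolf rate region of $(S,T)$, $$\mathcal R_{SW}=\{(R_1,R_2): R_1\ge H(S|T),\ R_2\ge H(T|S),\ R_1+R_2\ge H(S,T)\}.$$ Then $\mathcal C\cap\mathcal R_{SW}=\emptyset$ (so lossless transmission is not attainable by concatenating a Slepian–Wolf code with an optimal channel code), whereas $(S,T)$ is admissible for this channel; indeed, choosing $X_1=S$ and $X_2=T$ results in zero error probability at both receivers. Consequently, separate source and channel coding is strictly suboptimal for communicating correlated sources over interference channels.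
   Context: $H$ denotes Shannon entropy with logarithms to base 2. Source: $(S^n,T^n)$ is i.i.d. with $p(s^n,t^n)=\prod_{i=1}^n p(s_i,t_i)$; the channel is used memorylessly $n$ times. Code: a length-$n$ source-channel block code consists of encoders $f_1:\mathcal S^n\to\mathcal X_1^n$, $f_2:\mathcal T^n\to\mathcal X_2^n$ and decoders $\phi_1:\mathcal Y_1^n\to\mathcal S^n$, $\phi_2:\mathcal Y_2^n\to\mathcal T^n$. The channel inputs are $X_1^n=f_1(S^n)$ and $X_2^n=f_2(T^n)$. The error probabilities are $P_{e1}=\Pr\{S^n\ne\phi_1(Y_1^n)\}$ and $P_{e2}=\Pr\{T^n\ne\phi_2(Y_2^n)\}$. Admissibility: $(S,T)$ is admissible for the channel if for every $\epsilon\in(0,1)$ and all sufficiently large $n$ there exists a length-$n$ block code with $\max\{P_{e1},P_{e2}\}\le\epsilon$. The formula for $\mathcal C$ is the known capacity region (El Gamal–Costa) of this deterministic interference channel and may be taken as the definition of $\mathcal C$. The separation approach means Slepian–Wolf source coding at some rate pair $(R_1,R_2)$ followed by channel coding for independent messages at that rate pair; it is possible only if $\mathcal R_{SW}$ and $\mathcal C$ intersect. *)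

theory Defs
  imports "HOL-Probability.Probability" "HOL-Library.NList"
begin

text \<open>
  Shannon entropy in bits of a random variable on a discrete probability space. The reference
  measure is counting measure on the whole (countable) type, so that points outside the
  support contribute nothing.
\<close>

definition entropy_bits :: "'a pmf \<Rightarrow> ('a \<Rightarrow> 'b::countable) \<Rightarrow> real" where
  "entropy_bits p X = prob_space.entropy (measure_pmf p) 2 (count_space UNIV) X"

definition cond_entropy_bits ::
    "'a pmf \<Rightarrow> ('a \<Rightarrow> 'b::countable) \<Rightarrow> ('a \<Rightarrow> 'c::countable) \<Rightarrow> real" where
  "cond_entropy_bits p X Y =
     prob_space.conditional_entropy (measure_pmf p) 2 (count_space UNIV) (count_space UNIV) X Y"

definition slepian_wolf_region :: "('s::countable \<times> 't::countable) pmf \<Rightarrow> (real \<times> real) set" where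
  "slepian_wolf_region p =
     {(R1, R2). R1 \<ge> cond_entropy_bits p fst snd \<and>
                R2 \<ge> cond_entropy_bits p snd fst \<and>
                R1 + R2 \<ge> entropy_bits p (\<lambda>st. st)}"


text \<open>
  A discrete memoryless interference channel: finite input and output alphabets and a one-letter
  transition law \<open>p(y1, y2 | x1, x2)\<close>.
\<close>

record ('x1, 'x2, 'y1, 'y2) interference_channel =
  inp1 :: "'x1 set"
  inp2 :: "'x2 set"
  out1 :: "'y1 set"
  out2 :: "'y2 set"
  law :: "'x1 \<Rightarrow> 'x2 \<Rightarrow> ('y1 \<times> 'y2) pmf"

primrec memoryless ::
    "('x1 \<Rightarrow> 'x2 \<Rightarrow> ('y1 \<times> 'y2) pmf) \<Rightarrow> ('x1 \<times> 'x2) list \<Rightarrow> ('y1 \<times> 'y2) list pmf" where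
  "memoryless W [] = return_pmf []"
| "memoryless W (x # xs) =
     do {y \<leftarrow> W (fst x) (snd x); ys \<leftarrow> memoryless W xs; return_pmf (y # ys)}"

record ('s, 't, 'x1, 'x2, 'y1, 'y2) block_code =
  enc1 :: "'s list \<Rightarrow> 'x1 list"
  enc2 :: "'t list \<Rightarrow> 'x2 list"
  dec1 :: "'y1 list \<Rightarrow> 's list"
  dec2 :: "'y2 list \<Rightarrow> 't list"

definition is_block_code ::
    "'s set \<Rightarrow> 't set \<Rightarrow> ('x1, 'x2, 'y1, 'y2) interference_channel \<Rightarrow> nat
     \<Rightarrow> ('s, 't, 'x1, 'x2, 'y1, 'y2) block_code \<Rightarrow> bool" where
  "is_block_code S T Ch n c \<longleftrightarrow>
     enc1 c \<in> nlists n S \<rightarrow> nlists n (inp1 Ch) \<and>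
     enc2 c \<in> nlists n T \<rightarrow> nlists n (inp2 Ch) \<and>
     dec1 c \<in> nlists n (out1 Ch) \<rightarrow> nlists n S \<and>
     dec2 c \<in> nlists n (out2 Ch) \<rightarrow> nlists n T"

text \<open>Joint law of the source block \<open>(S, T)\<^sup>n\<close> and the output block \<open>(Y1, Y2)\<^sup>n\<close>.\<close>

definition transmission ::
    "('s \<times> 't) pmf \<Rightarrow> ('x1, 'x2, 'y1, 'y2) interference_channel \<Rightarrow> nat
     \<Rightarrow> ('s, 't, 'x1, 'x2, 'y1, 'y2) block_code
     \<Rightarrow> (('s \<times> 't) list \<times> ('y1 \<times> 'y2) list) pmf" where
  "transmission p Ch n c =
     do {st \<leftarrow> replicate_pmf n p;
         y \<leftarrow> memoryless (law Ch) (zip (enc1 c (map fst st)) (enc2 c (map snd st)));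
         return_pmf (st, y)}"

definition error1 ::
    "('s \<times> 't) pmf \<Rightarrow> ('x1, 'x2, 'y1, 'y2) interference_channel \<Rightarrow> nat
     \<Rightarrow> ('s, 't, 'x1, 'x2, 'y1, 'y2) block_code \<Rightarrow> real" where
  "error1 p Ch n c =
     measure_pmf.prob (transmission p Ch n c) {(st, y). map fst st \<noteq> dec1 c (map fst y)}"

definition error2 ::
    "('s \<times> 't) pmf \<Rightarrow> ('x1, 'x2, 'y1, 'y2) interference_channel \<Rightarrow> nat
     \<Rightarrow> ('s, 't, 'x1, 'x2, 'y1, 'y2) block_code \<Rightarrow> real" where
  "error2 p Ch n c =
     measure_pmf.prob (transmission p Ch n c) {(st, y). map snd st \<noteq> dec2 c (map snd y)}"

definition admissible ::
    "'s set \<Rightarrow> 't set \<Rightarrow> ('s \<times> 't) pmf \<Rightarrow> ('x1, 'x2, 'y1, 'y2) interference_channel \<Rightarrow> bool" where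
  "admissible S T p Ch \<longleftrightarrow>
     (\<forall>\<epsilon>::real. 0 < \<epsilon> \<and> \<epsilon> < 1 \<longrightarrow>
        (\<forall>\<^sub>F n in sequentially. \<exists>c. is_block_code S T Ch n c \<and>
           max (error1 p Ch n c) (error2 p Ch n c) \<le> \<epsilon>))"


text \<open>
  Slepian--Wolf coding at a rate pair: two encoders that do not cooperate, with \<open>M1\<close> and \<open>M2\<close>
  indices, and a decoder that sees both indices.
\<close>

definition slepian_wolf_attainable ::
    "'s set \<Rightarrow> 't set \<Rightarrow> ('s \<times> 't) pmf \<Rightarrow> real \<Rightarrow> real \<Rightarrow> bool" where
  "slepian_wolf_attainable S T p R1 R2 \<longleftrightarrow>
     (\<forall>\<delta>::real. \<forall>\<epsilon>::real. 0 < \<delta> \<and> 0 < \<epsilon> \<and> \<epsilon> < 1 \<longrightarrow>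
        (\<forall>\<^sub>F n in sequentially. \<exists>(M1::nat) (M2::nat) f1 f2 g.
           real M1 \<le> 2 powr (real n * (R1 + \<delta>)) \<and> real M2 \<le> 2 powr (real n * (R2 + \<delta>)) \<and>
           f1 \<in> nlists n S \<rightarrow> {..<M1} \<and> f2 \<in> nlists n T \<rightarrow> {..<M2} \<and>
           g \<in> {..<M1} \<times> {..<M2} \<rightarrow> nlists n S \<times> nlists n T \<and>
           measure_pmf.prob (replicate_pmf n p)
             {st. g (f1 (map fst st), f2 (map snd st)) \<noteq> (map fst st, map snd st)} \<le> \<epsilon>))"

text \<open>
  Separation over a channel whose capacity region for independent messages is \<open>C\<close>:
  Slepian--Wolf coding at a rate pair at which the two indices can be sent over the channel.
\<close>

definition separation_attainable ::
    "'s set \<Rightarrow> 't set \<Rightarrow> ('s \<times> 't) pmf \<Rightarrow> (real \<times> real) set \<Rightarrow> bool" where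
  "separation_attainable S T p C \<longleftrightarrow> (\<exists>(R1, R2) \<in> C. slepian_wolf_attainable S T p R1 R2)"


definition adder_channel :: "(nat, nat, nat, nat) interference_channel" where
  "adder_channel =
     \<lparr>inp1 = {0, 1}, inp2 = {0, 1}, out1 = {0, 1}, out2 = {0, 1, 2},
      law = (\<lambda>x1 x2. return_pmf (x1, x1 + x2))\<rparr>"

text \<open>
  The capacity region of \<open>adder_channel\<close> for independent messages, by the El Gamal--Costa
  formula. The input pair \<open>(X1, X2)\<close> is the identity on \<open>pair_pmf p1 p2\<close>.
\<close>

definition adder_capacity_region :: "(real \<times> real) set" where
  "adder_capacity_region = closure (convex hull
     {(R1, R2). 0 \<le> R1 \<and> 0 \<le> R2 \<and>
        (\<exists>(p1 :: nat pmf) (p2 :: nat pmf). set_pmf p1 \<subseteq> {0, 1} \<and> set_pmf p2 \<subseteq> {0, 1} \<and>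
           R1 \<le> entropy_bits (pair_pmf p1 p2) (\<lambda>(x1, x2). x1) \<and>
           R2 \<le> entropy_bits (pair_pmf p1 p2) (\<lambda>(x1, x2). x2) \<and>
           R1 + R2 \<le> entropy_bits (pair_pmf p1 p2) (\<lambda>(x1, x2). x1 + x2))})"

end

theory Submission
  imports Defs
begin

text \<open>
  The source has joint entropy \<open>log 2 3\<close>. The law \<open>(r0, r1, r2)\<close> of
  \<open>Y2 = X1 + X2\<close> with independent inputs satisfies \<open>4 r0 r2 \<le> r1\<^sup>2\<close>, which keeps it away from
  the uniform law and bounds its entropy by \<open>11/7 < log 2 3\<close>. Hence the sum rate on the capacity
  region is too small for Slepian--Wolf coding. That Slepian--Wolf coding really needs the sum rate
  \<open>log 2 3\<close> is a counting argument, since every source block has probability at most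
  \<open>3\<^sup>-\<^sup>n\<close>. With the source used as channel input, the missing pair \<open>(0, 1)\<close> makes
  \<open>T\<close> a function of \<open>S + T\<close>.
\<close>

section \<open>Entropy as a finite sum and Gibbs' inequality\<close>

lemma entropy_bits_eq_sum:
  fixes X :: "'a \<Rightarrow> 'b::countable"
  assumes A: "finite A" and XA: "X ` set_pmf p \<subseteq> A"
  shows "entropy_bits p X = - (\<Sum>x\<in>A. pmf (map_pmf X p) x * log 2 (pmf (map_pmf X p) x))"
proof -
  interpret information_space "measure_pmf p" 2
    by unfold_locales simp
  have "distributed (measure_pmf p) (count_space UNIV) X (\<lambda>x. ennreal (pmf (map_pmf X p) x))"
    using measure_pmf_eq_density[of "map_pmf X p"]
    unfolding distributed_def map_pmf_rep_eq by simp
  then have "entropy_bits p X =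
      - (\<integral>x. pmf (map_pmf X p) x * log 2 (pmf (map_pmf X p) x) \<partial>count_space UNIV)"
    unfolding entropy_bits_def by (rule entropy_distr) simp
  also have "(\<integral>x. pmf (map_pmf X p) x * log 2 (pmf (map_pmf X p) x) \<partial>count_space UNIV)
      = (\<Sum>x\<in>A. pmf (map_pmf X p) x * log 2 (pmf (map_pmf X p) x))"
  proof -
    have sub: "{x. pmf (map_pmf X p) x * log 2 (pmf (map_pmf X p) x) \<noteq> 0} \<subseteq> A"
      using XA by (auto simp: pmf_eq_0_set_pmf)
    then have "finite {x. pmf (map_pmf X p) x * log 2 (pmf (map_pmf X p) x) \<noteq> 0}"
      using A by (rule finite_subset)
    then show ?thesis
      using sub A by (subst lebesgue_integral_count_space_finite_support)
        (auto intro!: sum.mono_neutral_left)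
  qed
  finally show ?thesis .
qed

text \<open>Gibbs' inequality, from \<open>ln u \<le> u - 1\<close> at \<open>u = q x / r x\<close>,
  where \<open>r\<close> is the law of \<open>X\<close>. Its use is that for a fixed
  \<open>q\<close> the bound is linear in the law of \<open>X\<close>.\<close>

lemma entropy_bits_le_cross_entropy:
  fixes X :: "'a \<Rightarrow> 'b::countable"
  assumes A: "finite A" and XA: "X ` set_pmf p \<subseteq> A"
    and q: "\<And>x. x \<in> A \<Longrightarrow> 0 < q x" and q1: "sum q A \<le> 1"
  shows "entropy_bits p X \<le> - (\<Sum>x\<in>A. pmf (map_pmf X p) x * log 2 (q x))"
proof -
  let ?r = "pmf (map_pmf X p)"
  have term_le: "?r x * ln (q x) - ?r x * ln (?r x) \<le> q x - ?r x" if "x \<in> A" for x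
  proof (cases "?r x = 0")
    case True
    then show ?thesis using q[OF that] by simp
  next
    case False
    then have r: "0 < ?r x" using pmf_nonneg[of "map_pmf X p" x] by linarith
    have "ln (q x / ?r x) \<le> q x / ?r x - 1"
      using r q[OF that] by (intro ln_le_minus_one) simp
    then have "?r x * ln (q x / ?r x) \<le> ?r x * (q x / ?r x - 1)"
      using r by (intro mult_left_mono) auto
    also have "\<dots> = q x - ?r x" using False by (simp add: right_diff_distrib)
    finally show ?thesis
      using r q[OF that] by (simp add: ln_div right_diff_distrib)
  qed
  have "(\<Sum>x\<in>A. ?r x * ln (q x)) - (\<Sum>x\<in>A. ?r x * ln (?r x)) \<le> sum q A - sum ?r A"
    using sum_mono[of A, OF term_le] by (simp add: sum_subtractf)
  also have "sum ?r A = 1"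
    using XA by (intro sum_pmf_eq_1 A) simp
  finally have "(\<Sum>x\<in>A. ?r x * ln (q x)) \<le> (\<Sum>x\<in>A. ?r x * ln (?r x))"
    using q1 by linarith
  then have "(\<Sum>x\<in>A. ?r x * ln (q x)) / ln 2 \<le> (\<Sum>x\<in>A. ?r x * ln (?r x)) / ln 2"
    by (rule divide_right_mono) simp
  then show ?thesis
    unfolding entropy_bits_eq_sum[OF A XA] log_def by (simp add: sum_divide_distrib)
qed

section \<open>Sum rate of the capacity region\<close>

lemma log2_3_gt: "11/7 < log 2 (3::real)"
proof -
  \<comment> \<open>This is 2048 < 2187.\<close>
  have "log 2 (2 ^ 11) < log 2 ((3::real) ^ 7)"
    by (subst log_less_cancel_iff) simp_all
  then have "real 11 * log 2 2 < real 7 * log 2 (3::real)"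
    by (simp only: log_nat_power zero_less_numeral)
  then show ?thesis by simp
qed

text \<open>
  One of \<open>r0 \<ge> 1/2\<close>, \<open>r2 \<ge> 1/2\<close>, \<open>r1 \<ge> 2/5\<close> always holds, since otherwise
  \<open>r1\<^sup>2 - 4 r0 r2 = (r0 - r2)\<^sup>2 - (1 - 2 r1)\<close> would be negative. In each case a different fixed
  reference law gives a cross entropy that is linear in \<open>(r0, r1, r2)\<close> and below \<open>log 2 3\<close>.
\<close>

lemma entropy_le_of_square_dominates:
  fixes X :: "'a \<Rightarrow> nat"
  assumes X: "X ` set_pmf p \<subseteq> {0, 1, 2}"
    and dom: "4 * pmf (map_pmf X p) 0 * pmf (map_pmf X p) 2 \<le> (pmf (map_pmf X p) 1)\<^sup>2"
  shows "entropy_bits p X \<le> 11/7"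
proof -
  define r0 r1 r2 where r: "r0 = pmf (map_pmf X p) 0" "r1 = pmf (map_pmf X p) 1"
    "r2 = pmf (map_pmf X p) 2"
  have dom: "4 * r0 * r2 \<le> r1\<^sup>2" using dom by (simp only: r)
  have nn: "0 \<le> r0" "0 \<le> r1" "0 \<le> r2" by (simp_all add: r)
  have "sum (pmf (map_pmf X p)) {0, 1, 2} = 1"
    using X by (intro sum_pmf_eq_1) auto
  then have sum1: "r0 + r1 + r2 = 1" by (simp add: r)
  have cross: "entropy_bits p X \<le> - (r0 * log 2 a + r1 * log 2 b + r2 * log 2 c)"
    if "0 < a" "0 < b" "0 < c" "a + b + c \<le> 1" for a b c
  proof -
    define q where "q = (\<lambda>i::nat. if i = 0 then a else if i = 1 then b else c)"
    have "entropy_bits p X \<le> - (\<Sum>x\<in>{0, 1, 2}. pmf (map_pmf X p) x * log 2 (q x))"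
      using that X by (intro entropy_bits_le_cross_entropy) (auto simp: q_def)
    then show ?thesis by (simp add: q_def r)
  qed
  have log4: "log 2 (1/4::real) = -2"
    using log_nat_power[of "1/2::real" 2 2] by (simp add: log_divide power2_eq_square)
  have log2: "log 2 (1/2::real) = -1"
    by (simp add: log_divide)
  consider "1/2 \<le> r0" | "1/2 \<le> r2" | "2/5 \<le> r1"
  proof -
    have False if lt: "r0 < 1/2" "r2 < 1/2" "r1 < 2/5"
    proof -
      \<comment> \<open>Total mass 1 and \<open>r0 < 1/2\<close> give \<open>r0 < r1 + r2\<close>;
        likewise for \<open>r2\<close>.\<close>
      have "\<bar>r0 - r2\<bar> \<le> r1" using lt sum1 by linarith
      then have "(r0 - r2)\<^sup>2 \<le> r1\<^sup>2" using nn by (metis abs_le_square_iff abs_of_nonneg)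
      moreover have "(r0 - r2)\<^sup>2 = (1 - r1)\<^sup>2 - 4 * r0 * r2"
      proof -
        have r1: "1 - r1 = r0 + r2" using sum1 by linarith
        show ?thesis unfolding r1 by (simp add: power2_eq_square algebra_simps)
      qed
      \<comment> \<open>This forces \<open>r1 \<ge> sqrt 2 - 1\<close>, and 2/5 is a rational just
        below that threshold.\<close>
      ultimately have "(1 - r1)\<^sup>2 \<le> 2 * r1\<^sup>2"
        using dom by linarith
      moreover have "(3/5)\<^sup>2 \<le> (1 - r1)\<^sup>2" "r1\<^sup>2 \<le> (2/5)\<^sup>2"
        using lt nn by (intro power_mono; linarith)+
      moreover have "2 * (2/5)\<^sup>2 < (3/5 :: real)\<^sup>2" by (simp add: power2_eq_square)
      ultimately show False by linarith
    qed
    then show ?thesis using that by (meson not_le)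
  qed
  then show ?thesis
  proof cases
    case 1
    \<comment> \<open>The cross entropy is \<open>2 - r0\<close>, at most 3/2.\<close>
    then show ?thesis using cross[of "1/2" "1/4" "1/4"] sum1 by (simp add: log4 log2)
  next
    case 2
    then show ?thesis using cross[of "1/4" "1/4" "1/2"] sum1 by (simp add: log4 log2)
  next
    case 3
    \<comment> \<open>The reference law gives \<open>r0\<close> and \<open>r2\<close> equal weight,
      so only \<open>r1\<close> remains. Since 2/5 > 3/10, the bound decreases in \<open>r1\<close>
      and is largest at \<open>r1 = 2/5\<close>.\<close>
    have "entropy_bits p X \<le> - ((1 - r1) * log 2 (3/10) + r1 * log 2 (2/5))"
    proof -
      have "entropy_bits p X \<le> - (r0 * log 2 (3/10) + r1 * log 2 (2/5) + r2 * log 2 (3/10))"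
        by (rule cross) simp_all
      moreover have "1 - r1 = r0 + r2" using sum1 by linarith
      ultimately show ?thesis by (simp only: distrib_right)
    qed
    also have "\<dots> = - log 2 (3/10) - r1 * (log 2 (2/5) - log 2 (3/10))"
      by (simp add: algebra_simps)
    also have "\<dots> \<le> - log 2 (3/10) - 2/5 * (log 2 (2/5) - log 2 (3/10))"
      using 3 by (intro diff_left_mono mult_right_mono) simp_all
    also have "\<dots> \<le> 11/7"
    proof -
      \<comment> \<open>The inequality to prove, multiplied by 35 so that all coefficients are
        integers.\<close>
      have "log 2 ((1/2) ^ 55) \<le> log 2 ((3/10) ^ 21 * (2/5) ^ 14 :: real)"
        by (subst log_le_cancel_iff) (simp_all add: power_divide)
      also have "\<dots> = log 2 ((3/10) ^ 21) + log 2 ((2/5) ^ 14)"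
        by (rule log_mult_pos) simp_all
      finally have "real 55 * log 2 (1/2) \<le> real 21 * log 2 (3/10) + real 14 * log 2 (2/5)"
        by (subst (asm) (1 2 3) log_nat_power) simp_all
      then have "- 55 \<le> 21 * log 2 (3/10) + 14 * log 2 (2/5 :: real)"
        unfolding log2 by simp
      then show ?thesis unfolding right_diff_distrib by linarith
    qed
    finally show ?thesis .
  qed
qed

text \<open>If \<open>a\<close> and \<open>b\<close> are the probabilities of input 0, then
  \<open>r0 = a b\<close>, \<open>r2 = (1 - a)(1 - b)\<close>, and \<open>r1\<close> is the sum of
  \<open>a (1 - b)\<close> and \<open>b (1 - a)\<close>, whose product is \<open>r0 r2\<close>. The
  domination is thus AM-GM, with defect \<open>(a - b)^2\<close>.\<close>

lemma entropy_binary_sum_le: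
  fixes p1 p2 :: "nat pmf"
  assumes "set_pmf p1 \<subseteq> {0, 1}" and "set_pmf p2 \<subseteq> {0, 1}"
  shows "entropy_bits (pair_pmf p1 p2) (\<lambda>(x1, x2). x1 + x2) \<le> 11/7"
proof (rule entropy_le_of_square_dominates)
  let ?X = "\<lambda>(x1, x2). x1 + x2 :: nat"
  let ?P = "pair_pmf p1 p2"
  show sub: "?X ` set_pmf ?P \<subseteq> {0, 1, 2}" using assms by fastforce
  define a b where ab: "a = pmf p1 0" "b = pmf p2 0"
  have "sum (pmf p1) {0, 1} = 1" "sum (pmf p2) {0, 1} = 1"
    using assms by (intro sum_pmf_eq_1; simp)+
  then have p1: "pmf p1 (Suc 0) = 1 - a" "pmf p2 (Suc 0) = 1 - b" by (simp_all add: ab)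
  have "?X -` {0} = {(0, 0)}" by auto
  then have r0: "pmf (map_pmf ?X ?P) 0 = a * b"
    by (simp add: pmf_map measure_pmf_single pmf_pair ab)
  \<comment> \<open>Over the naturals 2 is also 0 + 2 and 2 + 0; only the support excludes
    these.\<close>
  have "(?X -` {2}) \<inter> set_pmf ?P = {(1, 1)} \<inter> set_pmf ?P"
    using assms by fastforce
  then have "measure_pmf.prob ?P (?X -` {2}) = measure_pmf.prob ?P {(1, 1)}"
    by (metis measure_Int_set_pmf)
  then have r2: "pmf (map_pmf ?X ?P) 2 = (1 - a) * (1 - b)"
    by (simp add: pmf_map measure_pmf_single pmf_pair p1)
  have "sum (pmf (map_pmf ?X ?P)) {0, 1, 2} = 1"
    using sub by (intro sum_pmf_eq_1) auto
  then have r1: "pmf (map_pmf ?X ?P) 1 = 1 - a * b - (1 - a) * (1 - b)"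
    using r0 r2 by simp
  have "(1 - a * b - (1 - a) * (1 - b))\<^sup>2 - 4 * (a * b) * ((1 - a) * (1 - b)) = (a - b)\<^sup>2"
    by (simp add: power2_eq_square algebra_simps)
  then show "4 * pmf (map_pmf ?X ?P) 0 * pmf (map_pmf ?X ?P) 2 \<le> (pmf (map_pmf ?X ?P) 1)\<^sup>2"
    unfolding r0 r1 r2 using zero_le_power2[of "a - b"] by linarith
qed

text \<open>A half-plane is convex and closed, so a bound on the sum rate survives the convex hull
  and the closure.\<close>

lemma adder_capacity_region_sum_le:
  assumes "(R1, R2) \<in> adder_capacity_region"
  shows "R1 + R2 \<le> 11/7"
proof -
  let ?H = "{x :: real \<times> real. (1, 1) \<bullet> x \<le> 11/7}"
  have "adder_capacity_region \<subseteq> ?H"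
    unfolding adder_capacity_region_def
    by (intro closure_minimal hull_minimal closed_halfspace_le convex_halfspace_le)
      (use entropy_binary_sum_le in fastforce)
  then show ?thesis using assms by auto
qed

section \<open>Counting converse for Slepian-Wolf coding\<close>

lemma pmf_replicate_le:
  assumes "\<And>x. pmf p x \<le> c" and "0 \<le> c"
  shows "pmf (replicate_pmf n p) xs \<le> c ^ n"
proof (induction n arbitrary: xs)
  case 0
  then show ?case by (simp add: pmf_le_1)
next
  case (Suc n)
  have eq: "replicate_pmf (Suc n) p = map_pmf (\<lambda>(x, xs). x # xs) (pair_pmf p (replicate_pmf n p))"
    by (simp add: pair_pmf_def map_bind_pmf bind_return_pmf bind_assoc_pmf)
  show ?case
  proof (cases xs)
    case Nil
    then have "xs \<notin> set_pmf (replicate_pmf (Suc n) p)"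
      by (simp add: set_replicate_pmf del: replicate_pmf.simps)
    then show ?thesis using assms by (simp add: set_pmf_iff del: replicate_pmf.simps)
  next
    case (Cons y ys)
    have "(\<lambda>(x, xs). x # xs) -` {xs} = {(y, ys)}" using Cons by auto
    then have "pmf (replicate_pmf (Suc n) p) xs = pmf p y * pmf (replicate_pmf n p) ys"
      unfolding eq by (simp add: pmf_map measure_pmf_single pmf_pair)
    also have "\<dots> \<le> c * c ^ n"
      using assms Suc by (intro mult_mono) simp_all
    finally show ?thesis by simp
  qed
qed

text \<open>A correctly decoded block is determined by its index pair, so at most
  \<open>M1 * M2\<close> blocks of the support are decoded correctly, each of mass at most
  \<open>c ^ n\<close>.\<close>

lemma slepian_wolf_prob_correct_le:
  fixes p :: "('s \<times> 't) pmf" and M1 M2 :: nat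
  assumes supp: "set_pmf p \<subseteq> S \<times> T" and c: "\<And>x. pmf p x \<le> c" "0 \<le> c"
    and f: "f1 \<in> nlists n S \<rightarrow> {..<M1}" "f2 \<in> nlists n T \<rightarrow> {..<M2}"
  shows "measure_pmf.prob (replicate_pmf n p)
      {st. g (f1 (map fst st), f2 (map snd st)) = (map fst st, map snd st)}
    \<le> real M1 * real M2 * c ^ n"
proof -
  let ?P = "replicate_pmf n p"
  let ?C = "{st. g (f1 (map fst st), f2 (map snd st)) = (map fst st, map snd st)}"
  let ?h = "\<lambda>st. (f1 (map fst st), f2 (map snd st))"
  have ls: "map fst st \<in> nlists n S \<and> map snd st \<in> nlists n T" if "st \<in> set_pmf ?P" for st
  proof -
    have "\<forall>x\<in>set st. x \<in> S \<times> T" "length st = n"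
      using that supp by (auto simp: set_replicate_pmf)
    then show ?thesis by (fastforce intro!: nlistsI)
  qed
  have inj: "inj_on ?h (?C \<inter> set_pmf ?P)"
  proof (rule inj_onI)
    fix s t assume s: "s \<in> ?C \<inter> set_pmf ?P" and t: "t \<in> ?C \<inter> set_pmf ?P" and h: "?h s = ?h t"
    have "(map fst s, map snd s) = g (?h s)" using s by auto
    also have "\<dots> = g (?h t)" by (simp only: h)
    also have "\<dots> = (map fst t, map snd t)" using t by auto
    finally have "zip (map fst s) (map snd s) = zip (map fst t) (map snd t)" by simp
    then show "s = t" by (simp only: zip_map_fst_snd)
  qed
  \<comment> \<open>Blocks of the support lie over \<open>S\<close> and \<open>T\<close> and have
    length \<open>n\<close>, where the encoders are known to map into the index sets.\<close>
  have sub: "?h ` (?C \<inter> set_pmf ?P) \<subseteq> {..<M1} \<times> {..<M2}"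
    using f ls by fastforce
  have fin: "finite (?C \<inter> set_pmf ?P)"
    using inj sub by (rule inj_on_finite) simp
  have card: "card (?C \<inter> set_pmf ?P) \<le> M1 * M2"
    using card_inj_on_le[OF inj sub] by (simp add: card_cartesian_product)
  have "measure_pmf.prob ?P ?C = (\<Sum>x\<in>?C \<inter> set_pmf ?P. pmf ?P x)"
    by (metis (no_types) fin measure_Int_set_pmf measure_measure_pmf_finite)
  also have "\<dots> \<le> (\<Sum>x\<in>?C \<inter> set_pmf ?P. c ^ n)"
    by (intro sum_mono pmf_replicate_le c)
  also have "\<dots> = real (card (?C \<inter> set_pmf ?P)) * c ^ n" by simp
  also have "\<dots> \<le> real (M1 * M2) * c ^ n"
    using card c by (intro mult_right_mono) (simp_all only: of_nat_le_iff zero_le_power)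
  finally show ?thesis by simp
qed

text \<open>Below this sum rate the probability of correct decoding decays geometrically. For a
  source uniform on its support, with \<open>c\<close> its largest mass, \<open>- log 2 c\<close>
  equals the joint entropy.\<close>

lemma slepian_wolf_attainable_sum_ge:
  assumes att: "slepian_wolf_attainable S T p R1 R2"
    and supp: "set_pmf p \<subseteq> S \<times> T" and c: "\<And>x. pmf p x \<le> c" "0 < c"
  shows "R1 + R2 \<ge> - log 2 c"
proof (rule ccontr)
  assume "\<not> ?thesis"
  then have lt: "R1 + R2 < - log 2 c" by simp
  \<comment> \<open>A quarter of the gap: the two rates each spend one \<open>\<delta>\<close>,
    leaving the exponent \<open>- 2 * \<delta>\<close> per letter.\<close>
  define \<delta> where "\<delta> = (- log 2 c - (R1 + R2)) / 4"
  define \<rho> where "\<rho> = 2 powr (- 2 * \<delta>)"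
  have \<delta>: "0 < \<delta>" using lt by (simp add: \<delta>_def)
  then have \<rho>: "0 < \<rho>" "\<rho> < 1"
    using powr_less_mono[of "- 2 * \<delta>" 0 2] by (simp_all add: \<rho>_def)
  have \<rho>_eq: "2 powr (R1 + \<delta>) * 2 powr (R2 + \<delta>) * c = \<rho>"
  proof -
    have "c = 2 powr (log 2 c)" using c by simp
    then have "2 powr (R1 + \<delta>) * 2 powr (R2 + \<delta>) * c
        = 2 powr ((R1 + \<delta>) + (R2 + \<delta>) + log 2 c)"
      by (simp only: powr_add)
    also have "(R1 + \<delta>) + (R2 + \<delta>) + log 2 c = - 2 * \<delta>" by (simp add: \<delta>_def field_simps)
    finally show ?thesis by (simp add: \<rho>_def)
  qed
  have "\<forall>\<^sub>F n in sequentially. \<rho> ^ n < 1/2"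
    using LIMSEQ_power_zero[of \<rho>] \<rho> by (intro order_tendstoD(2)[where y = 0]) auto
  moreover have "\<forall>\<^sub>F n in sequentially. \<exists>(M1::nat) (M2::nat) f1 f2 g.
       real M1 \<le> 2 powr (real n * (R1 + \<delta>)) \<and> real M2 \<le> 2 powr (real n * (R2 + \<delta>)) \<and>
       f1 \<in> nlists n S \<rightarrow> {..<M1} \<and> f2 \<in> nlists n T \<rightarrow> {..<M2} \<and>
       g \<in> {..<M1} \<times> {..<M2} \<rightarrow> nlists n S \<times> nlists n T \<and>
       measure_pmf.prob (replicate_pmf n p)
         {st. g (f1 (map fst st), f2 (map snd st)) \<noteq> (map fst st, map snd st)} \<le> 1/2"
    using att[unfolded slepian_wolf_attainable_def, rule_format, of \<delta> "1/2"] \<delta> by simp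
  ultimately have "\<forall>\<^sub>F n in sequentially. False"
  proof eventually_elim
    case (elim n)
    then obtain M1 M2 :: nat and f1 f2 g where
      M: "real M1 \<le> 2 powr (real n * (R1 + \<delta>))" "real M2 \<le> 2 powr (real n * (R2 + \<delta>))"
      and f: "f1 \<in> nlists n S \<rightarrow> {..<M1}" "f2 \<in> nlists n T \<rightarrow> {..<M2}"
      and err: "measure_pmf.prob (replicate_pmf n p)
         {st. g (f1 (map fst st), f2 (map snd st)) \<noteq> (map fst st, map snd st)} \<le> 1/2"
      by blast
    let ?C = "{st. g (f1 (map fst st), f2 (map snd st)) = (map fst st, map snd st)}"
    have "{st. g (f1 (map fst st), f2 (map snd st)) \<noteq> (map fst st, map snd st)}
        = space (measure_pmf (replicate_pmf n p)) - ?C" by auto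
    then have "1/2 \<le> measure_pmf.prob (replicate_pmf n p) ?C"
      using err measure_pmf.prob_compl[of ?C "replicate_pmf n p"] by simp
    also have "\<dots> \<le> real M1 * real M2 * c ^ n"
      using c by (intro slepian_wolf_prob_correct_le[OF supp _ _ f]) simp_all
    also have "\<dots> \<le> 2 powr (real n * (R1 + \<delta>)) * 2 powr (real n * (R2 + \<delta>)) * c ^ n"
      using M c by (intro mult_right_mono mult_mono) simp_all
    also have "\<dots> = (2 powr (R1 + \<delta>)) ^ n * (2 powr (R2 + \<delta>)) ^ n * c ^ n"
      by (simp add: powr_power mult.commute)
    also have "\<dots> = \<rho> ^ n"
      unfolding \<rho>_eq[symmetric] by (simp only: power_mult_distrib)
    finally show False using elim by simp
  qed
  then show False by simp
qed

section \<open>Uncoded transmission\<close>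

lemma memoryless_deterministic:
  assumes "\<And>x1 x2. W x1 x2 = return_pmf (w (x1, x2))"
  shows "memoryless W xs = return_pmf (map w xs)"
  by (induction xs) (simp_all add: assms bind_return_pmf)

lemma uncoded_transmission:
  assumes "enc1 c = (\<lambda>s. s)" and "enc2 c = (\<lambda>t. t)"
  shows "transmission p adder_channel n c
    = map_pmf (\<lambda>st. (st, map (\<lambda>(s, t). (s, s + t)) st)) (replicate_pmf n p)"
proof -
  have "memoryless (law adder_channel) xs = return_pmf (map (\<lambda>(s, t). (s, s + t)) xs)" for xs
    by (rule memoryless_deterministic) (simp add: adder_channel_def)
  then show ?thesis
    by (simp add: transmission_def assms zip_map_fst_snd bind_return_pmf map_pmf_def)
qed

lemma uncoded_adder_zero_error:
  fixes p :: "(nat \<times> nat) pmf"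
  assumes supp: "set_pmf p \<subseteq> {(0, 0), (1, 0), (1, 1)}"
  shows "\<exists>c. is_block_code {0, 1} {0, 1} adder_channel n c
    \<and> enc1 c = (\<lambda>s. s) \<and> enc2 c = (\<lambda>t. t)
    \<and> error1 p adder_channel n c = 0 \<and> error2 p adder_channel n c = 0"
proof -
  \<comment> \<open>On the support, output 2 comes only from (1, 1), while outputs 0 and 1 come from
    (0, 0) and (1, 0), both with \<open>T = 0\<close>.\<close>
  define d :: "nat \<Rightarrow> nat" where "d = (\<lambda>y. if y = 2 then 1 else 0)"
  define c :: "(nat, nat, nat, nat, nat, nat) block_code" where
    "c = \<lparr>enc1 = (\<lambda>s. s), enc2 = (\<lambda>t. t), dec1 = (\<lambda>y. y), dec2 = map d\<rparr>"
  have enc: "enc1 c = (\<lambda>s. s)" "enc2 c = (\<lambda>t. t)" by (simp_all add: c_def)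
  have code: "is_block_code {0, 1} {0, 1} adder_channel n c"
    unfolding is_block_code_def
  proof (intro conjI funcsetI)
    fix y assume "y \<in> nlists n (out2 adder_channel)"
    then have "length y = n" by simp
    then show "dec2 c y \<in> nlists n {0, 1}"
      by (intro nlistsI) (auto simp: c_def d_def)
  qed (simp_all add: c_def adder_channel_def)
  have "error1 p adder_channel n c = 0"
    unfolding error1_def uncoded_transmission[OF enc]
    by (auto simp: measure_pmf_zero_iff c_def)
  moreover have "error2 p adder_channel n c = 0"
  proof -
    have d: "d (a + b) = b" if "(a, b) \<in> set_pmf p" for a b
      using that supp by (auto simp: d_def)
    have "map d (map snd (map (\<lambda>(s, t). (s, s + t)) st)) = map snd st"
      if "st \<in> set_pmf (replicate_pmf n p)" for st
      using that by (auto simp: set_replicate_pmf intro!: d)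
    then show ?thesis
      unfolding error2_def uncoded_transmission[OF enc]
      by (auto simp: measure_pmf_zero_iff c_def simp del: map_map list.map_comp map_eq_conv)
  qed
  ultimately show ?thesis using code enc by blast
qed

theorem mainTheorem5:
  fixes p :: "(nat \<times> nat) pmf"
  assumes "pmf p (0, 0) = 1/3" and "pmf p (1, 0) = 1/3" and "pmf p (1, 1) = 1/3"
    and "pmf p (0, 1) = 0"
  shows "adder_capacity_region \<inter> slepian_wolf_region p = {}
    \<and> \<not> separation_attainable {0, 1} {0, 1} p adder_capacity_region
    \<and> (\<forall>n. \<exists>c. is_block_code {0, 1} {0, 1} adder_channel n c
          \<and> enc1 c = (\<lambda>s. s) \<and> enc2 c = (\<lambda>t. t)
          \<and> error1 p adder_channel n c = 0 \<and> error2 p adder_channel n c = 0)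
    \<and> admissible {0, 1} {0, 1} p adder_channel"
proof -
  let ?A = "{(0, 0), (1, 0), (1, 1)} :: (nat \<times> nat) set"
  \<comment> \<open>The source type is all pairs of naturals; total mass 1 on \<open>?A\<close>
    keeps letters beyond 0 and 1 out of the support.\<close>
  have "measure_pmf.prob p ?A = 1"
    using assms by (simp add: measure_measure_pmf_finite)
  then have supp: "set_pmf p \<subseteq> ?A"
    using measure_pmf.AE_prob_1[of p ?A] by (simp add: AE_measure_pmf_iff subset_eq)
  then have supp2: "set_pmf p \<subseteq> {0, 1} \<times> {0, 1}" by auto
  have le: "pmf p x \<le> 1/3" for x
    using assms supp by (cases "x \<in> set_pmf p") (auto simp: set_pmf_iff)
  have log3: "log 2 (1/3::real) = - log 2 3" by (simp add: log_divide)
  have "entropy_bits p (\<lambda>st. st) = - (\<Sum>x\<in>?A. pmf p x * log 2 (pmf p x))"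
    using entropy_bits_eq_sum[of ?A "\<lambda>st. st" p] supp by simp
  also have "\<dots> = - (\<Sum>x\<in>?A. 1/3 * log 2 (1/3))"
    by (simp add: assms del: One_nat_def)
  also have "\<dots> = log 2 3" by (simp add: log3)
  finally have sw: "R1 + R2 > 11/7" if "(R1, R2) \<in> slepian_wolf_region p" for R1 R2
    using that log2_3_gt by (simp add: slepian_wolf_region_def)
  have "adder_capacity_region \<inter> slepian_wolf_region p = {}"
  proof (rule equals0I, clarify)
    fix R1 R2 assume "(R1, R2) \<in> adder_capacity_region" "(R1, R2) \<in> slepian_wolf_region p"
    then show False using adder_capacity_region_sum_le sw by (meson not_less)
  qed
  \<comment> \<open>Disjointness from the entropy region does not by itself limit actual codes; the
    counting converse with \<open>c = 1/3\<close> does.\<close>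
  moreover have "\<not> separation_attainable {0, 1} {0, 1} p adder_capacity_region"
    unfolding separation_attainable_def
  proof clarify
    fix R1 R2 assume "(R1, R2) \<in> adder_capacity_region"
      and "slepian_wolf_attainable {0, 1} {0, 1} p R1 R2"
    then show False
      using adder_capacity_region_sum_le[of R1 R2]
        slepian_wolf_attainable_sum_ge[OF _ supp2 le, of R1 R2] log2_3_gt log3 by simp
  qed
  moreover have code: "\<exists>c. is_block_code {0, 1} {0, 1} adder_channel n c
          \<and> enc1 c = (\<lambda>s. s) \<and> enc2 c = (\<lambda>t. t)
          \<and> error1 p adder_channel n c = 0 \<and> error2 p adder_channel n c = 0" for n
    by (rule uncoded_adder_zero_error[OF supp])
  moreover have "admissible {0, 1} {0, 1} p adder_channel"
    unfolding admissible_def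
  proof (intro allI impI always_eventually)
    fix \<epsilon> :: real and n assume "0 < \<epsilon> \<and> \<epsilon> < 1"
    then show "\<exists>c. is_block_code {0, 1} {0, 1} adder_channel n c \<and>
        max (error1 p adder_channel n c) (error2 p adder_channel n c) \<le> \<epsilon>"
      using code[of n] by (metis less_imp_le max.idem)
  qed
  ultimately show ?thesis by blast
qed

end
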